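(* There exists a string family on which $\ell_p = \Omega(\ell_m\sqrt{n})$, where $n$ is the length of the string.
   Context: A string family is an infinite set of finite strings of unbounded length; asymptotic notation on a family refers to strings $w$ of the family with $n=|w|\to\infty$ (with constants uniform over the family). $w[i:j]$ denotes the substring of $w$ from position $i$ to position $j$ (positions start at 1). L-systems: an L-system is a tuple $(\Sigma,\varphi,\tau,s,d,n)$, where $\Sigma$ is a finite alphabet, $\varphi:\Sigma^*\to\Sigma^*$ is a non-erasing monoid endomorphism (each rule $a\to\varphi(a)$, $a\in\Sigma$, has $|\varphi(a)|\ge 1$), $\tau:\Sigma^*\to\Sigma^*$ is a coding (a morphism with $|\tau(a)|=1$ for all $a\in\Sigma$), $s\in\Sigma^+$ is the axiom, and $d\ge 0$, $n\ge 1$ are integers. It generates the unique string $\tau(\varphi^d(s))[1:n]$ of length $n$. It is always assumed that $d=n^{O(1)}$ and $|\Sigma|=n^{O(1)}$ (each value fits in an $O(\log n)$-bit word). The size of the L-system is $\sum_{a\in\Sigma}|\varphi(a)|+|s|+|\Sigma|+2$. An L-system is prolongable if there is a symbol $a$ such that $s=a$ and $\varphi(a)=ax$ with $x\neq\varepsilon$ (the empty string). $\ell_m(w)$ is the size of the smallest prolongable L-system generating $w$. $\ell_p(w)$ is the size of the smallest prolongable L-system generating $w$ whose coding $\tau$ is the identity function. *)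

theory Defs
  imports Complex_Main "HOL-Library.Landau_Symbols"
begin

text \<open>
  Symbols are natural numbers, so that the minima below range over L-systems with arbitrarily large
  finite alphabets. The endomorphism and the coding are given by their values on symbols; only the
  values on the alphabet matter.
\<close>

record lsystem =
  alphabet :: "nat set"
  rule :: "nat \<Rightarrow> nat list"
  coding :: "nat \<Rightarrow> nat"
  start :: "nat list"
  depth :: nat
  len :: nat

definition lsystem_wf :: "lsystem \<Rightarrow> bool" where
  "lsystem_wf L \<longleftrightarrow>
     finite (alphabet L) \<and>
     (\<forall>a\<in>alphabet L. rule L a \<noteq> [] \<and> set (rule L a) \<subseteq> alphabet L) \<and>
     (\<forall>a\<in>alphabet L. coding L a \<in> alphabet L) \<and>
     start L \<noteq> [] \<and> set (start L) \<subseteq> alphabet L \<and>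
     len L \<ge> 1"

definition morph :: "(nat \<Rightarrow> nat list) \<Rightarrow> nat list \<Rightarrow> nat list" where
  "morph f u = concat (map f u)"

text \<open>
  The length condition excludes systems whose final string is too short to have a prefix of
  length \<open>len L\<close>.
\<close>

definition generates :: "lsystem \<Rightarrow> nat list \<Rightarrow> bool" where
  "generates L w \<longleftrightarrow>
     length w = len L \<and>
     w = take (len L) (map (coding L) ((morph (rule L) ^^ depth L) (start L)))"

definition lsize :: "lsystem \<Rightarrow> nat" where
  "lsize L = (\<Sum>a\<in>alphabet L. length (rule L a)) + length (start L) + card (alphabet L) + 2"

definition prolongable :: "lsystem \<Rightarrow> bool" where
  "prolongable L \<longleftrightarrow> (\<exists>a x. start L = [a] \<and> rule L a = a # x \<and> x \<noteq> [])"

definition identity_coding :: "lsystem \<Rightarrow> bool" where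
  "identity_coding L \<longleftrightarrow> (\<forall>a\<in>alphabet L. coding L a = a)"

text \<open>
  The standing assumption that the depth and the alphabet size are polynomial in the length of the
  generated string, with the exponent \<open>k\<close> made explicit.
\<close>

definition poly_bounded :: "nat \<Rightarrow> lsystem \<Rightarrow> bool" where
  "poly_bounded k L \<longleftrightarrow> depth L \<le> len L ^ k \<and> card (alphabet L) \<le> len L ^ k"

definition ell_m :: "nat \<Rightarrow> nat list \<Rightarrow> nat" where
  "ell_m k w = Inf {lsize L | L.
     lsystem_wf L \<and> poly_bounded k L \<and> prolongable L \<and> generates L w}"

definition ell_p :: "nat \<Rightarrow> nat list \<Rightarrow> nat" where
  "ell_p k w = Inf {lsize L | L.
     lsystem_wf L \<and> poly_bounded k L \<and> prolongable L \<and> identity_coding L \<and> generates L w}"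

text \<open>
  For nonempty \<open>w\<close> and \<open>k \<ge> 1\<close> neither infimum is over the empty set, so both are attained minima.
\<close>

lemma prolongable_system_exists:
  assumes "w \<noteq> []" and "k \<ge> 1"
  shows "\<exists>L. lsystem_wf L \<and> poly_bounded k L \<and> prolongable L \<and> identity_coding L \<and> generates L w"
proof -
  define L where "L = \<lparr>alphabet = set w,
    rule = (\<lambda>a. if length w = 1 then w @ w else w), coding = (\<lambda>a. a),
    start = [hd w], depth = 1, len = length w\<rparr>"
  have "length w \<ge> 1" using assms(1) by (cases w) auto
  then have "1 \<le> length w ^ k" "length w \<le> length w ^ k"
    using assms(2) by (auto intro: self_le_power)
  moreover have "card (set w) \<le> length w" by (rule card_length)
  ultimately have "poly_bounded k L"
    unfolding poly_bounded_def L_def by (simp; linarith)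
  moreover have "prolongable L"
    using assms(1) unfolding prolongable_def L_def by (cases w) auto
  moreover have "lsystem_wf L"
    using assms(1) \<open>length w \<ge> 1\<close> unfolding lsystem_wf_def L_def by auto
  moreover have "identity_coding L" unfolding identity_coding_def L_def by simp
  moreover have "generates L w" unfolding generates_def L_def morph_def by simp
  ultimately show ?thesis by blast
qed

definition string_family :: "nat list set \<Rightarrow> bool" where
  "string_family F \<longleftrightarrow> infinite F \<and> (\<forall>N. \<exists>w\<in>F. length w \<ge> N)"

text \<open>The filter of strings \<open>w\<close> of the family \<open>F\<close> with length tending to infinity.\<close>

definition along :: "nat list set \<Rightarrow> nat list filter" where
  "along F = inf (filtercomap length at_top) (principal F)"

lemma eventually_along:
  "eventually P (along F) \<longleftrightarrow> (\<exists>N. \<forall>w\<in>F. length w \<ge> N \<longrightarrow> P w)"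
  unfolding along_def eventually_inf_principal eventually_filtercomap_at_top_linorder by blast

end

theory Submission
  imports Defs
begin

text \<open>
  The family consists of the strings \<open>0 0 2\<^sup>m\<close>. With a coding, \<open>0 \<rightarrow> 0 1\<close>, \<open>1 \<rightarrow> 2\<close>, \<open>2 \<rightarrow> 2\<close> iterates to
  \<open>0 1 2\<^sup>m\<close>, and identifying \<open>1\<close> with \<open>0\<close> gives a system of size 10. Without a coding, the image \<open>u\<close> of
  the axiom \<open>0\<close> is a prefix of length at least 2; if it were proper, then \<open>u\<close> would start with \<open>0 0\<close>,
  the string would start with \<open>u u\<close>, and a third \<open>0\<close> would occur. So \<open>u\<close> is as long as the whole
  string, which gives even a linear separation.
\<close>

lemma morph_Cons [simp]: "morph f (a # u) = f a @ morph f u"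
  by (simp add: morph_def)

lemma morph_append [simp]: "morph f (u @ v) = morph f u @ morph f v"
  by (simp add: morph_def)

lemma morph_Nil [simp]: "morph f [] = []"
  by (simp add: morph_def)

lemma set_morph_iterate_subset:
  assumes "\<And>a. a \<in> A \<Longrightarrow> set (f a) \<subseteq> A" and "set u \<subseteq> A"
  shows "set ((morph f ^^ d) u) \<subseteq> A"
proof (induction d)
  case (Suc d)
  then show ?case using assms(1) by (auto simp: morph_def)
qed (use assms(2) in simp)

text \<open>Since \<open>f a\<close> begins with \<open>a\<close>, each further application of
  \<open>morph f\<close> reproduces the prefix \<open>a # x\<close>. The exponent starts at 1
  because the zeroth iterate is just \<open>[a]\<close>.\<close>

lemma morph_iterate_prefix:
  assumes "f a = a # x"
  shows "\<exists>y. (morph f ^^ Suc d) [a] = a # x @ y"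
proof (induction d)
  case (Suc d)
  then obtain y where "(morph f ^^ Suc d) [a] = a # x @ y" by blast
  then show ?case using assms by simp
qed (simp add: assms)

lemma length_rule_le_lsize:
  assumes "lsystem_wf L" and "a \<in> alphabet L"
  shows "length (rule L a) \<le> lsize L"
proof -
  have "length (rule L a) \<le> (\<Sum>b\<in>alphabet L. length (rule L b))"
    using assms by (intro member_le_sum) (auto simp: lsystem_wf_def)
  then show ?thesis by (simp add: lsize_def)
qed

lemma generates_identity_coding:
  assumes "lsystem_wf L" and "identity_coding L" and "generates L w"
  shows "w = take (length w) ((morph (rule L) ^^ depth L) (start L))"
proof -
  have "set ((morph (rule L) ^^ depth L) (start L)) \<subseteq> alphabet L"
    using assms(1) by (intro set_morph_iterate_subset) (auto simp: lsystem_wf_def)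
  then have "map (coding L) ((morph (rule L) ^^ depth L) (start L))
      = (morph (rule L) ^^ depth L) (start L)"
    using assms(2) by (intro map_idI) (auto simp: identity_coding_def)
  then show ?thesis using assms(3) unfolding generates_def by metis
qed

definition hard_string :: "nat \<Rightarrow> nat list" where
  "hard_string m = [0, 0] @ replicate m 2"

lemma length_hard_string [simp]: "length (hard_string m) = m + 2"
  by (simp add: hard_string_def)

lemma hard_string_nth:
  assumes "i < m + 2"
  shows "hard_string m ! i = (if i < 2 then 0 else 2)"
  using assms by (auto simp: hard_string_def nth_append nth_Cons' less_Suc_eq)

lemma lsize_ge_of_generates_hard_string:
  assumes wf: "lsystem_wf L" and "prolongable L" and "identity_coding L"
    and "generates L (hard_string m)"
  shows "m + 2 \<le> lsize L"
proof -
  let ?v = "\<lambda>d. (morph (rule L) ^^ d)"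
  obtain a x where st: "start L = [a]" and ru: "rule L a = a # x" and x: "x \<noteq> []"
    using assms(2) by (auto simp: prolongable_def)
  have w: "hard_string m = take (m + 2) (?v (depth L) [a])"
    using generates_identity_coding[OF assms(1,3,4)] st by simp
  then have "length (take (m + 2) (?v (depth L) [a])) = m + 2"
    by (metis length_hard_string)
  then have lenv: "m + 2 \<le> length (?v (depth L) [a])" by simp
  have nth: "hard_string m ! i = ?v (depth L) [a] ! i" if "i < m + 2" for i
    using w that by (metis nth_take)
  have "m + 2 \<le> length (rule L a)"
  proof (rule ccontr)
    assume "\<not> m + 2 \<le> length (rule L a)"
    then have short: "length (a # x) < m + 2" using ru by simp
    \<comment> \<open>Depths 0 and 1 yield \<open>[a]\<close> and \<open>a # x\<close>, both shorter
      than \<open>m + 2\<close>. Hence at least two applications occur, and the last one acts on a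
      string that already starts with \<open>a # x\<close>.\<close>
    have "depth L \<noteq> 0" using lenv by (intro notI) simp
    moreover have "depth L \<noteq> 1" using lenv short ru by (intro notI) simp
    ultimately obtain d where d: "depth L = Suc (Suc d)"
      by (metis One_nat_def not0_implies_Suc)
    obtain b x' where x': "x = b # x'" using x by (cases x) auto
    obtain y where "?v (Suc d) [a] = a # x @ y"
      using morph_iterate_prefix[of "rule L", OF ru] by blast
    \<comment> \<open>The last application expands the first symbol \<open>a\<close> to
      \<open>a # x\<close> and the second symbol \<open>b\<close> to \<open>rule L b\<close>, so the
      image of \<open>b\<close> starts at position \<open>length (a # x)\<close>.\<close>
    then have v: "?v (depth L) [a] = (a # x) @ rule L b @ morph (rule L) (x' @ y)"
      using d ru x' by simp
    have "a = 0" using nth[of 0] v hard_string_nth[of 0 m] by simp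
    moreover have "b = 0" using nth[of 1] v x' hard_string_nth[of 1 m] by simp
    \<comment> \<open>Both \<open>a\<close> and \<open>b\<close> are \<open>0\<close>, so
      \<open>rule L b\<close> is the image of the axiom once more and begins with
      \<open>0\<close>.\<close>
    ultimately have "?v (depth L) [a] = (a # x) @ 0 # x @ morph (rule L) (x' @ y)"
      using v ru by simp
    then have "hard_string m ! length (a # x) = 0"
      using nth[OF short] by (metis nth_append_length)
    \<comment> \<open>As \<open>x\<close> is nonempty, this position is at least 2, where the string
      carries \<open>2\<close>.\<close>
    then show False using hard_string_nth[OF short] x' by simp
  qed
  also have "\<dots> \<le> lsize L"
    using wf st by (intro length_rule_le_lsize) (auto simp: lsystem_wf_def)
  finally show ?thesis .
qed

text \<open>A lower bound for all systems bounds the infimum only over a nonempty set;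
  \<open>k \<ge> 1\<close> secures a witness.\<close>

lemma ell_p_hard_string:
  assumes "k \<ge> 1"
  shows "m + 2 \<le> ell_p k (hard_string m)"
proof -
  have "hard_string m \<noteq> []" by (simp add: hard_string_def)
  then have "\<exists>L. lsystem_wf L \<and> poly_bounded k L \<and> prolongable L \<and> identity_coding L \<and>
      generates L (hard_string m)"
    using assms by (rule prolongable_system_exists)
  then show ?thesis
    unfolding ell_p_def
    by (intro cInf_greatest) (use lsize_ge_of_generates_hard_string in blast)+
qed

lemma ell_m_hard_string:
  assumes "k \<ge> 1" and "m \<ge> 1"
  shows "ell_m k (hard_string m) \<le> 10"
proof -
  define f where "f = (\<lambda>s::nat. if s = 0 then [0, 1] else [2::nat])"
  define L where "L = \<lparr>alphabet = {0, 1, 2}, rule = f,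
    coding = (\<lambda>s. if s = 1 then 0 else s), start = [0], depth = Suc m, len = m + 2\<rparr>"
  have rep: "morph f (replicate j 2) = replicate j 2" for j
    by (induction j) (simp_all add: f_def)
  have it: "(morph f ^^ Suc j) [0] = 0 # 1 # replicate j 2" for j
  proof (induction j)
    case (Suc j)
    have "(morph f ^^ Suc (Suc j)) [0] = morph f (0 # 1 # replicate j 2)"
      using Suc.IH by simp
    also have "\<dots> = 0 # 1 # replicate (Suc j) 2" by (simp add: rep) (simp add: f_def)
    finally show ?case .
  qed (simp add: f_def)
  \<comment> \<open>This covers the depth \<open>m + 1\<close>, and the three symbols as well,
    because \<open>m \<ge> 1\<close> gives \<open>3 \<le> m + 2\<close>.\<close>
  have "m + 2 \<le> (m + 2) ^ k" using assms(1) by (intro self_le_power) auto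
  then have "poly_bounded k L" using assms(2) by (simp add: poly_bounded_def L_def)
  moreover have "lsystem_wf L" by (auto simp: lsystem_wf_def L_def f_def)
  moreover have "prolongable L" by (simp add: prolongable_def L_def f_def)
  moreover have "generates L (hard_string m)"
    \<comment> \<open>The power stays folded so that \<open>it\<close> can rewrite it.\<close>
    using it[of m] by (simp add: generates_def L_def hard_string_def del: funpow.simps)
  \<comment> \<open>Rules contribute 2 + 1 + 1, the axiom 1, the alphabet 3, and the constant
    2.\<close>
  moreover have "lsize L = 10" by (simp add: lsize_def L_def f_def)
  ultimately show ?thesis
    unfolding ell_m_def by (intro cInf_lower) (auto intro!: exI[of _ L])
qed

theorem lemma7:
  "\<exists>F :: nat list set. string_family F \<and>
     (\<forall>k\<ge>1. (\<lambda>w. real (ell_p k w)) \<in> \<Omega>[along F](\<lambda>w. real (ell_m k w) * sqrt (real (length w))))"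
proof (intro exI conjI allI impI)
  have "inj hard_string"
    by (rule injI) (metis add_right_cancel length_hard_string)
  then have "infinite (range hard_string)" by (simp add: finite_image_iff)
  moreover have "\<exists>w\<in>range hard_string. length w \<ge> N" for N
    by (rule bexI[of _ "hard_string N"]) auto
  ultimately show "string_family (range hard_string)" by (simp add: string_family_def)
next
  fix k :: nat assume k: "k \<ge> 1"
  \<comment> \<open>Length at least 3 means \<open>m \<ge> 1\<close>, as the bound on
    \<open>ell_m\<close> requires. The factor 10 is that bound.\<close>
  have bound: "real (ell_m k w) * sqrt (real (length w)) \<le> 10 * real (ell_p k w)"
    if "w \<in> range hard_string" and "length w \<ge> 3" for w
  proof -
    from that(1) obtain m where w: "w = hard_string m" by blast
    have "real (ell_m k w) \<le> 10" using ell_m_hard_string[OF k, of m] that(2) w by simp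
    moreover have "sqrt (real (length w)) \<le> real (length w)"
      using that(2) by (intro real_le_lsqrt self_le_power) auto
    moreover have "real (length w) \<le> real (ell_p k w)"
      using ell_p_hard_string[OF k, of m] w by simp
    ultimately show ?thesis by (intro mult_mono) auto
  qed
  show "(\<lambda>w. real (ell_p k w)) \<in>
      \<Omega>[along (range hard_string)](\<lambda>w. real (ell_m k w) * sqrt (real (length w)))"
  proof (rule landau_omega.bigI[of "1/10"])
    show "\<forall>\<^sub>F w in along (range hard_string).
        1 / 10 * norm (real (ell_m k w) * sqrt (real (length w))) \<le> norm (real (ell_p k w))"
      unfolding eventually_along
    proof (intro exI ballI impI)
      fix w assume "w \<in> range hard_string" and "3 \<le> length w"
      from bound[OF this]
      show "1 / 10 * norm (real (ell_m k w) * sqrt (real (length w))) \<le> norm (real (ell_p k w))"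
        by simp
    qed
  qed simp
qed

end
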